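(* For every $0<\delta<1/2$, $$\kappa_{\mathrm{ch}}^{[0]}(\delta)=M_1(\delta),\qquad\kappa_{\mathrm{ch}}^{[1]}(\delta)=\kappa_{\mathrm{HC}}(\delta).$$
   Context: $H_2(t)=-t\log_2t-(1-t)\log_2(1-t)$ ($0\log_20=0$); $M_1(\delta)=H_2\big(\frac12-\sqrt{\delta(1-\delta)}\big)$. For positive semidefinite $M$ with trace at most one, $\mathsf S(M)=-\mathrm{tr}(M\log_2M)$. For $m\ge1$, $\mathcal K_m$ is the set of pairs $(K,L)$ of positive semidefinite Hermitian $m\times m$ complex matrices with $\mathrm{tr}(K+L)=1$; $\Gamma_{\mathrm{ch}}(K,L)=2\,\mathrm{tr}(K^{1/2}L^{1/2})$, $\Phi_{\mathrm{ch}}(K,L)=\mathsf S(K)+\mathsf S(L)-\mathsf S(K+L)$, and for $r\ge0$, $\kappa_{\mathrm{ch}}^{[r]}(\delta)=\inf\{\Phi_{\mathrm{ch}}(K,L):(K,L)\in\mathcal K_{r+1},\ \Gamma_{\mathrm{ch}}(K,L)>1-2\delta\}$. For $0<x\le\frac12$, $0\le\eta,\rho<\frac12$, $0\le z\le\frac12$ put $A=(1-x)(1-2\eta)$, $B=x(1-2\rho)$, $E=1-2z$; $\mathcal D_{\mathrm{HC}}$ is the set of such $(x,\eta,\rho,z)$ with $|A-B|\le E\le A+B$. Put $P=\frac{E^2-(A-B)^2}{4AB}$, $$\Gamma_{\mathrm{HC}}=2\sqrt{x(1-x)}\Big[P\big(\sqrt{(1-\eta)(1-\rho)}+\sqrt{\eta\rho}\big)+(1-P)\big(\sqrt{\rho(1-\eta)}+\sqrt{\eta(1-\rho)}\big)\Big],$$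 $\Phi_{\mathrm{HC}}=H_2(x)+(1-x)H_2(\eta)+xH_2(\rho)-H_2(z)$, and $\kappa_{\mathrm{HC}}(\delta)=\inf\{\Phi_{\mathrm{HC}}:(x,\eta,\rho,z)\in\mathcal D_{\mathrm{HC}},\ \Gamma_{\mathrm{HC}}>1-2\delta\}$. *)

theory Defs
  imports "Jordan_Normal_Form.Schur_Decomposition"
begin

section \<open>Binary entropy\<close>

text \<open>In Isabelle/HOL \<open>log 2 0 = 0\<close>, so the convention \<open>0 log 0 = 0\<close> is built in.\<close>

definition H2 :: "real \<Rightarrow> real" where
  "H2 t = - t * log 2 t - (1 - t) * log 2 (1 - t)"

definition M1 :: "real \<Rightarrow> real" where
  "M1 \<delta> = H2 (1/2 - sqrt (\<delta> * (1 - \<delta>)))"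


section \<open>Positive semidefinite matrices and functional calculus\<close>

definition hermitian :: "complex mat \<Rightarrow> bool" where
  "hermitian M \<longleftrightarrow> square_mat M \<and> mat_adjoint M = M"

definition unitary :: "complex mat \<Rightarrow> bool" where
  "unitary U \<longleftrightarrow> square_mat U \<and> mat_adjoint U * U = 1\<^sub>m (dim_row U)"

text \<open>The order on \<^typ>\<open>complex\<close> is the one in which \<open>0 \<le> z\<close> means that \<open>z\<close> is real and nonnegative.\<close>

definition psd :: "complex mat \<Rightarrow> bool" where
  "psd M \<longleftrightarrow> hermitian M \<and> (\<forall>v \<in> carrier_vec (dim_row M). 0 \<le> (M *\<^sub>v v) \<bullet>c v)"

definition mat_trace :: "complex mat \<Rightarrow> complex" where
  "mat_trace M = (\<Sum>i<dim_row M. M $$ (i, i))"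

text \<open>A pair \<open>U\<close>, \<open>d\<close> diagonalizes \<open>M\<close> if \<open>U\<close> is unitary and \<open>M = U diag(d) U*\<close> with \<open>d\<close> real.
  Such a pair exists for every Hermitian \<open>M\<close> by the spectral theorem, and
  \<open>f(M) = U diag(f(d)) U*\<close> does not depend on the choice (lemma \<open>herm_fun_eq\<close> below).\<close>

definition diagonalizes :: "complex mat \<Rightarrow> (nat \<Rightarrow> real) \<Rightarrow> complex mat \<Rightarrow> bool" where
  "diagonalizes U d M \<longleftrightarrow> unitary U \<and> dim_row U = dim_row M \<and>
     M = U * mat_diag (dim_row M) (\<lambda>i. complex_of_real (d i)) * mat_adjoint U"

definition herm_fun :: "(real \<Rightarrow> real) \<Rightarrow> complex mat \<Rightarrow> complex mat" where
  "herm_fun f M = (THE N. \<exists>U d. diagonalizes U d M \<and>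
     N = U * mat_diag (dim_row M) (\<lambda>i. complex_of_real (f (d i))) * mat_adjoint U)"

lemma mat_adjoint_dim [simp]:
  "dim_row (mat_adjoint (A :: complex mat)) = dim_col A" "dim_col (mat_adjoint A) = dim_row A"
  by (auto simp: mat_adjoint_def)

lemma unitary_carrierD:
  assumes "unitary U" "dim_row U = n"
  shows "U \<in> carrier_mat n n" "mat_adjoint U \<in> carrier_mat n n"
    "mat_adjoint U * U = 1\<^sub>m n" "U * mat_adjoint U = 1\<^sub>m n"
proof -
  show U: "U \<in> carrier_mat n n" and U': "mat_adjoint U \<in> carrier_mat n n"
    and 1: "mat_adjoint U * U = 1\<^sub>m n"
    using assms by (auto simp: unitary_def)
  show "U * mat_adjoint U = 1\<^sub>m n"
    by (rule mat_mult_left_right_inverse[OF U' U 1])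
qed

lemma diagonalizes_unique:
  assumes "diagonalizes U d M" "diagonalizes V e M"
  shows "U * mat_diag (dim_row M) (\<lambda>i. complex_of_real (f (d i))) * mat_adjoint U =
    V * mat_diag (dim_row M) (\<lambda>i. complex_of_real (f (e i))) * mat_adjoint V"
proof -
  define n where "n = dim_row M"
  define D where "D g a = mat_diag n (\<lambda>i. complex_of_real (g (a i :: real) :: real))" for g a
  have D [simp]: "D g a \<in> carrier_mat n n" for g a
    by (simp add: D_def)
  define U' V' where "U' = mat_adjoint U" and "V' = mat_adjoint V"
  have U: "U \<in> carrier_mat n n" "U' \<in> carrier_mat n n" "U' * U = 1\<^sub>m n" "U * U' = 1\<^sub>m n"
    and V: "V \<in> carrier_mat n n" "V' \<in> carrier_mat n n" "V' * V = 1\<^sub>m n" "V * V' = 1\<^sub>m n"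
    using unitary_carrierD[of U n] unitary_carrierD[of V n] assms
    by (auto simp: diagonalizes_def n_def U'_def V'_def)
  define W where "W = V' * U"
  note [simp] = mult_carrier_mat[of _ n n _ n] right_mult_one_mat[of _ n n] left_mult_one_mat[of _ n n]
  have W: "W \<in> carrier_mat n n" using U V by (simp add: W_def)
  note assoc = assoc_mult_mat[of _ n n _ n _ n]
  have cancel: "V' * (V * X) = X" "V * (V' * X) = X" if "X \<in> carrier_mat n n" for X
    using U V that by (simp_all flip: assoc)
  have eq: "U * D (\<lambda>x. x) d * U' = V * D (\<lambda>x. x) e * V'"
    using assms by (simp add: diagonalizes_def n_def D_def U'_def V'_def)
  have "W * D (\<lambda>x. x) d = V' * (U * D (\<lambda>x. x) d * U') * U"
    using U V by (simp add: W_def assoc)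
  also have "\<dots> = D (\<lambda>x. x) e * W"
    unfolding eq using U V by (simp add: W_def assoc cancel)
  finally have comm: "W * D (\<lambda>x. x) d = D (\<lambda>x. x) e * W" .
  have comm_f: "W * D f d = D f e * W"
  proof (rule eq_matI)
    fix i j assume "i < dim_row (D f e * W)" "j < dim_col (D f e * W)"
    hence ij: "i < n" "j < n" using W carrier_matD(1)[OF D[of f e]] by auto
    have "(W * D (\<lambda>x. x) d) $$ (i, j) = (D (\<lambda>x. x) e * W) $$ (i, j)"
      using comm by simp
    hence "W $$ (i, j) * complex_of_real (d j) = complex_of_real (e i) * W $$ (i, j)"
      using ij W by (simp add: D_def mat_diag_mult_left[OF W] mat_diag_mult_right[OF W])
    hence "W $$ (i, j) = 0 \<or> d j = e i"
      by auto
    thus "(W * D f d) $$ (i, j) = (D f e * W) $$ (i, j)"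
      using ij W by (auto simp: D_def mat_diag_mult_left[OF W] mat_diag_mult_right[OF W])
  qed (use W carrier_matD[OF D[of f e]] carrier_matD[OF D[of f d]] in auto)
  have "U * D f d * U' = V * (W * D f d) * U'"
    using U V by (simp add: W_def assoc cancel)
  also have "\<dots> = V * D f e * V'"
    unfolding comm_f using U V by (simp add: W_def assoc)
  finally show ?thesis
    by (simp add: n_def D_def U'_def V'_def)
qed

lemma herm_fun_eq:
  assumes "diagonalizes U d M"
  shows "herm_fun f M =
    U * mat_diag (dim_row M) (\<lambda>i. complex_of_real (f (d i))) * mat_adjoint U"
  unfolding herm_fun_def
  by (rule the_equality) (use assms diagonalizes_unique[OF _ assms] in blast)+


section \<open>The matrix optimization problem\<close>

definition entropy :: "complex mat \<Rightarrow> real" where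
  "entropy M = - Re (mat_trace (M * herm_fun (log 2) M))"

definition K_pairs :: "nat \<Rightarrow> (complex mat \<times> complex mat) set" where
  "K_pairs m = {(K, L). K \<in> carrier_mat m m \<and> L \<in> carrier_mat m m \<and>
     psd K \<and> psd L \<and> mat_trace (K + L) = 1}"

definition Gamma_ch :: "complex mat \<Rightarrow> complex mat \<Rightarrow> real" where
  "Gamma_ch K L = 2 * Re (mat_trace (herm_fun sqrt K * herm_fun sqrt L))"

definition Phi_ch :: "complex mat \<Rightarrow> complex mat \<Rightarrow> real" where
  "Phi_ch K L = entropy K + entropy L - entropy (K + L)"

text \<open>For \<open>\<delta> > 0\<close> the sets below are nonempty and bounded below by \<open>0\<close>, so that
  the real-valued \<open>Inf\<close> is the genuine infimum; the same holds for \<open>kappa_HC\<close>.\<close>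

definition kappa_ch :: "nat \<Rightarrow> real \<Rightarrow> real" where
  "kappa_ch r \<delta> =
     Inf {Phi_ch K L | K L. (K, L) \<in> K_pairs (r + 1) \<and> Gamma_ch K L > 1 - 2 * \<delta>}"


section \<open>The four-parameter optimization problem\<close>

definition A_HC :: "real \<Rightarrow> real \<Rightarrow> real" where
  "A_HC x \<eta> = (1 - x) * (1 - 2 * \<eta>)"

definition B_HC :: "real \<Rightarrow> real \<Rightarrow> real" where
  "B_HC x \<rho> = x * (1 - 2 * \<rho>)"

definition E_HC :: "real \<Rightarrow> real" where
  "E_HC z = 1 - 2 * z"

definition D_HC :: "(real \<times> real \<times> real \<times> real) set" where
  "D_HC = {(x, \<eta>, \<rho>, z). 0 < x \<and> x \<le> 1/2 \<and> 0 \<le> \<eta> \<and> \<eta> < 1/2 \<and> 0 \<le> \<rho> \<and> \<rho> < 1/2 \<and>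
     0 \<le> z \<and> z \<le> 1/2 \<and>
     \<bar>A_HC x \<eta> - B_HC x \<rho>\<bar> \<le> E_HC z \<and> E_HC z \<le> A_HC x \<eta> + B_HC x \<rho>}"

definition P_HC :: "real \<Rightarrow> real \<Rightarrow> real \<Rightarrow> real \<Rightarrow> real" where
  "P_HC x \<eta> \<rho> z =
     ((E_HC z)\<^sup>2 - (A_HC x \<eta> - B_HC x \<rho>)\<^sup>2) / (4 * A_HC x \<eta> * B_HC x \<rho>)"

definition Gamma_HC :: "real \<Rightarrow> real \<Rightarrow> real \<Rightarrow> real \<Rightarrow> real" where
  "Gamma_HC x \<eta> \<rho> z = 2 * sqrt (x * (1 - x)) *
     (P_HC x \<eta> \<rho> z * (sqrt ((1 - \<eta>) * (1 - \<rho>)) + sqrt (\<eta> * \<rho>)) +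
      (1 - P_HC x \<eta> \<rho> z) * (sqrt (\<rho> * (1 - \<eta>)) + sqrt (\<eta> * (1 - \<rho>))))"

definition Phi_HC :: "real \<Rightarrow> real \<Rightarrow> real \<Rightarrow> real \<Rightarrow> real" where
  "Phi_HC x \<eta> \<rho> z = H2 x + (1 - x) * H2 \<eta> + x * H2 \<rho> - H2 z"

definition kappa_HC :: "real \<Rightarrow> real" where
  "kappa_HC \<delta> = Inf {Phi_HC x \<eta> \<rho> z | x \<eta> \<rho> z.
     (x, \<eta>, \<rho>, z) \<in> D_HC \<and> Gamma_HC x \<eta> \<rho> z > 1 - 2 * \<delta>}"

end

theory Submission
  imports Defs
begin

text \<open>
  A Hermitian \<open>2 \<times> 2\<close> matrix is \<open>(t I + r n\<cdot>\<sigma>) / 2\<close> for a unit vector \<open>n\<close> in \<open>\<real>\<^sup>3\<close> and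
  \<open>r \<ge> 0\<close>; its eigenvalues are \<open>(t \<plusminus> r) / 2\<close>, and functional calculus changes \<open>t\<close> and \<open>r\<close> but not \<open>n\<close>.
  For a pair with \<open>tr L = x\<close>, lengths \<open>A\<close>, \<open>B\<close> and angle \<open>\<theta>\<close> between the two vectors, the length
  \<open>E\<close> of the sum obeys the law of cosines, and \<open>P = (1 + cos \<theta>) / 2\<close> is the squared overlap of the
  leading eigenvectors. So \<open>\<D>\<^bsub>HC\<^esub>\<close> parametrizes all pairs with \<open>x \<le> 1/2\<close> (no restriction, by
  symmetry) in which neither matrix is scalar. If one of them is scalar, then \<open>P\<close> is irrelevant
  and may be taken to be \<open>1\<close>; the pair is a limit of points of \<open>\<D>\<^bsub>HC\<^esub>\<close>, which does not change the
  infimum because the constraint is open and \<open>\<Phi>\<close> is continuous. For \<open>1 \<times> 1\<close> matrices one minimizes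
  \<open>H\<^sub>2\<close> over an open interval centred at \<open>1/2\<close>.
\<close>

section \<open>Hermitian matrices of size two\<close>

text \<open>Half of \<open>t\<close> times the identity plus the vector \<open>(x, y, z)\<close>
  paired with the Pauli matrices. So \<open>t\<close> is the trace, and the vector need not have
  length one.\<close>

definition bloch :: "real \<Rightarrow> real \<Rightarrow> real \<Rightarrow> real \<Rightarrow> complex mat" where
  "bloch t x y z = mat 2 2 (\<lambda>(i, j).
     if i = 0 then (if j = 0 then complex_of_real ((t + z) / 2) else Complex (x / 2) (- y / 2))
     else (if j = 0 then Complex (x / 2) (y / 2) else complex_of_real ((t - z) / 2)))"

lemma bloch_carrier [simp]: "bloch t x y z \<in> carrier_mat 2 2"
  and bloch_dim [simp]: "dim_row (bloch t x y z) = 2" "dim_col (bloch t x y z) = 2"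
  by (simp_all add: bloch_def)

lemma mat_adjoint_index [simp]:
  fixes A :: "complex mat"
  assumes "i < dim_col A" "j < dim_row A"
  shows "mat_adjoint A $$ (i, j) = cnj (A $$ (j, i))"
  using assms by (simp add: mat_adjoint_def mat_of_rows_def)

lemma less_two_cases: "i < (2::nat) \<Longrightarrow> (i = 0 \<Longrightarrow> P) \<Longrightarrow> (i = 1 \<Longrightarrow> P) \<Longrightarrow> P"
  by linarith

text \<open>The unit vector \<open>(a, u + \<i>w)\<close> is an eigenvector of \<open>n\<cdot>\<sigma>\<close> for the eigenvalue \<open>1\<close>, where \<open>n = (x, y, z)\<close>.\<close>

lemma ex_spinor:
  assumes "x\<^sup>2 + y\<^sup>2 + z\<^sup>2 = (1::real)"
  shows "\<exists>a u w. a\<^sup>2 + u\<^sup>2 + w\<^sup>2 = 1 \<and> x = 2 * a * u \<and> y = 2 * a * w \<and> z = a\<^sup>2 - u\<^sup>2 - w\<^sup>2"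
proof (cases "z = -1")
  case True
  with assms have "x\<^sup>2 + y\<^sup>2 = 0" by simp
  hence "x = 0" "y = 0" by (simp_all add: sum_power2_eq_zero_iff)
  with True show ?thesis by (intro exI[of _ 0] exI[of _ 1]) simp
next
  case False
  have "z\<^sup>2 \<le> 1" using assms by (metis add_increasing le_add_same_cancel2 order_refl zero_le_power2 add_nonneg_nonneg)
  hence "z > -1" using False by (simp add: abs_square_le_1)
  \<comment> \<open>The cosine of half the polar angle. It vanishes only at the south pole
    \<open>z = -1\<close>, which is split off above.\<close>
  define a where "a = sqrt ((1 + z) / 2)"
  have a: "a > 0" "a\<^sup>2 = (1 + z) / 2" using \<open>z > -1\<close> by (simp_all add: a_def)
  have "4 * a\<^sup>2 * ((x / (2 * a))\<^sup>2 + (y / (2 * a))\<^sup>2) = 1 - z\<^sup>2"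
  proof -
    have "4 * a\<^sup>2 * ((x / (2 * a))\<^sup>2 + (y / (2 * a))\<^sup>2) = x\<^sup>2 + y\<^sup>2"
      using a(1) by (simp add: power_divide flip: add_divide_distrib)
    thus ?thesis using assms by simp
  qed
  also have "\<dots> = 4 * a\<^sup>2 * ((1 - z) / 2)" unfolding a(2) by (simp add: field_simps power2_eq_square)
  finally have "(x / (2 * a))\<^sup>2 + (y / (2 * a))\<^sup>2 = (1 - z) / 2"
    using a(1) by (subst (asm) mult_left_cancel) simp_all
  thus ?thesis using a
    by (intro exI[of _ a] exI[of _ "x / (2 * a)"] exI[of _ "y / (2 * a)"]) simp
qed

text \<open>The first column is the spinor \<open>(a, u + i w)\<close>. The second is orthogonal to
  it and serves as the eigenvector for the eigenvalue -1.\<close>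

definition spinor_mat :: "real \<Rightarrow> real \<Rightarrow> real \<Rightarrow> complex mat" where
  "spinor_mat a u w = mat 2 2 (\<lambda>(i, j).
     if i = 0 then (if j = 0 then complex_of_real a else Complex (- u) w)
     else (if j = 0 then Complex u w else complex_of_real a))"

lemma spinor_mat_dim [simp]: "dim_row (spinor_mat a u w) = 2" "dim_col (spinor_mat a u w) = 2"
  by (simp_all add: spinor_mat_def)

lemma unitary_spinor_mat:
  assumes "a\<^sup>2 + u\<^sup>2 + w\<^sup>2 = 1"
  shows "unitary (spinor_mat a u w)"
  unfolding unitary_def
proof (intro conjI eq_matI)
  fix i j assume "i < dim_row (1\<^sub>m (dim_row (spinor_mat a u w)) :: complex mat)"
    "j < dim_col (1\<^sub>m (dim_row (spinor_mat a u w)) :: complex mat)"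
  hence "i < 2" "j < 2" by auto
  thus "(mat_adjoint (spinor_mat a u w) * spinor_mat a u w) $$ (i, j) =
      1\<^sub>m (dim_row (spinor_mat a u w)) $$ (i, j)"
    using assms
    by (auto elim!: less_two_cases simp: scalar_prod_def numeral_2_eq_2)
       (auto simp: spinor_mat_def complex_eq_iff power2_eq_square algebra_simps)
qed simp_all

text \<open>The projections onto the two columns are the halves of identity plus and minus
  \<open>n\<cdot>\<sigma>\<close>, where \<open>n\<close> is the direction belonging to the spinor.
  Weighting them by \<open>d 0\<close> and \<open>d 1\<close> gives the trace
  \<open>d 0 + d 1\<close> and the vector \<open>d 0 - d 1\<close> times \<open>n\<close>.\<close>

lemma spinor_mat_diag:
  assumes "a\<^sup>2 + u\<^sup>2 + w\<^sup>2 = 1"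
  shows "spinor_mat a u w * mat_diag 2 (\<lambda>i. complex_of_real (d i)) * mat_adjoint (spinor_mat a u w)
    = bloch (d 0 + d 1) ((d 0 - d 1) * (2 * a * u)) ((d 0 - d 1) * (2 * a * w))
        ((d 0 - d 1) * (a\<^sup>2 - u\<^sup>2 - w\<^sup>2))" (is "?L = ?R")
proof (rule eq_matI)
  have U: "spinor_mat a u w \<in> carrier_mat 2 2" by (simp add: spinor_mat_def)
  fix i j assume "i < dim_row ?R" "j < dim_col ?R"
  hence ij: "i < 2" "j < 2" by auto
  \<comment> \<open>The norm condition in the nested, multiplied-out shape that simplification
    leaves in the entries.\<close>
  have 1: "a * (a * c) + (u * (u * c) + w * (w * c)) = c" for c
    using arg_cong[OF assms, of "\<lambda>s. s * c"] by (simp add: power2_eq_square algebra_simps)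
  hence 2: "a * (a * c) + (u * (u * c) + (w * (w * c) + e)) = c + e" for c e
    by (metis add.assoc)
  from ij show "?L $$ (i, j) = ?R $$ (i, j)"
    unfolding mat_diag_mult_right[OF U]
    by (auto elim!: less_two_cases simp: scalar_prod_def numeral_2_eq_2)
       (auto simp: spinor_mat_def bloch_def complex_eq_iff power2_eq_square field_simps,
        simp_all only: 1 2)
qed auto

text \<open>The unit vector is kept apart from the factor \<open>r\<close>, so a scalar matrix is
  the case \<open>r = 0\<close> with any direction and needs no exception.\<close>

lemma herm_fun_bloch:
  assumes "x\<^sup>2 + y\<^sup>2 + z\<^sup>2 = 1"
  shows "herm_fun f (bloch t (r * x) (r * y) (r * z)) =
    (let p = f ((t + r) / 2); q = f ((t - r) / 2) in bloch (p + q) ((p - q) * x) ((p - q) * y) ((p - q) * z))"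
proof -
  obtain a u w where 1: "a\<^sup>2 + u\<^sup>2 + w\<^sup>2 = 1" and x: "x = 2 * a * u" "y = 2 * a * w" "z = a\<^sup>2 - u\<^sup>2 - w\<^sup>2"
    using ex_spinor[OF assms] by blast
  define d where "d i = (if i = 0 then (t + r) / 2 else (t - r) / 2)" for i :: nat
  have d: "d 0 + d 1 = t" "d 0 - d 1 = r" by (simp_all add: d_def field_simps)
  have "diagonalizes (spinor_mat a u w) d (bloch t (r * x) (r * y) (r * z))"
    unfolding diagonalizes_def using unitary_spinor_mat[OF 1] spinor_mat_diag[OF 1, of d]
    by (simp add: d x del: One_nat_def)
  from herm_fun_eq[OF this, of f] spinor_mat_diag[OF 1, of "f \<circ> d"]
  show ?thesis by (simp add: x Let_def d_def)
qed

text \<open>The identity and the Pauli matrices are orthogonal for the trace form, each with squared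
  norm 2.\<close>

lemma trace_bloch_mult:
  "mat_trace (bloch t x y z * bloch t' x' y' z') = complex_of_real ((t * t' + x * x' + y * y' + z * z') / 2)"
  by (simp add: mat_trace_def numeral_2_eq_2 scalar_prod_def)
     (simp add: bloch_def complex_eq_iff field_simps)

lemma ex_direction:
  fixes x y z :: real
  shows "\<exists>r x' y' z'. r \<ge> 0 \<and> x'\<^sup>2 + y'\<^sup>2 + z'\<^sup>2 = 1 \<and> x = r * x' \<and> y = r * y' \<and> z = r * z'"
  proof (cases "x\<^sup>2 + y\<^sup>2 + z\<^sup>2 = 0")
    case True
    hence "x = 0" "y = 0" "z = 0"
      by (smt (verit) zero_le_power2 zero_less_power2)+
    thus ?thesis by (intro exI[of _ 0] exI[of _ 1]) simp
  next
    case False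
    define r where "r = sqrt (x\<^sup>2 + y\<^sup>2 + z\<^sup>2)"
    have r: "r\<^sup>2 = x\<^sup>2 + y\<^sup>2 + z\<^sup>2" "r > 0" using False
      by (simp_all add: r_def order_less_le)
    hence "(x / r)\<^sup>2 + (y / r)\<^sup>2 + (z / r)\<^sup>2 = 1"
      using False by (simp add: power_divide r(1) flip: add_divide_distrib)
    with r(2) show ?thesis by (intro exI[of _ r] exI[of _ "x / r"] exI[of _ "y / r"] exI[of _ "z / r"]) simp
  qed

lemma hermitian_eq_bloch:
  assumes "hermitian M" "M \<in> carrier_mat 2 2"
  shows "\<exists>t r x y z. r \<ge> 0 \<and> x\<^sup>2 + y\<^sup>2 + z\<^sup>2 = 1 \<and> M = bloch t (r * x) (r * y) (r * z)"
proof -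
  have h: "M $$ (i, j) = cnj (M $$ (j, i))" if "i < 2" "j < 2" for i j
    using assms that mat_adjoint_index[of i M j] by (simp add: hermitian_def)
  define p where "p = Re (M $$ (0, 0))"
  define q where "q = Re (M $$ (1, 1))"
  define v where "v = M $$ (1, 0)"
  have M: "M = bloch (p + q) (2 * Re v) (2 * Im v) (p - q)"
    by (rule eq_matI)
       (use assms h[of 0 0] h[of 1 1] h[of 0 1] in
         \<open>auto elim!: less_two_cases simp: bloch_def p_def q_def v_def complex_eq_iff\<close>)
  with ex_direction[of "2 * Re v" "2 * Im v" "p - q"] show ?thesis by metis
qed

text \<open>The factors of \<open>x\<close>, \<open>y\<close>, \<open>z\<close> are the expectations
  of the Pauli matrices in \<open>v\<close>, that is, the Bloch vector of \<open>v\<close>.\<close>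

lemma bloch_quadratic_form:
  assumes "v \<in> carrier_vec 2"
  shows "(bloch t x y z *\<^sub>v v) \<bullet>c v = complex_of_real
     ((t * ((cmod (v $ 0))\<^sup>2 + (cmod (v $ 1))\<^sup>2) + z * ((cmod (v $ 0))\<^sup>2 - (cmod (v $ 1))\<^sup>2)
       + x * (2 * Re (cnj (v $ 0) * v $ 1)) + y * (2 * Im (cnj (v $ 0) * v $ 1))) / 2)"
  using assms
proof -
  obtain p q where 0: "v $ 0 = Complex p q" by (cases "v $ 0")
  obtain u w where 1: "v $ Suc 0 = Complex u w" by (cases "v $ Suc 0")
  show ?thesis using assms unfolding cmod_power2 One_nat_def 0 1
    by (simp add: scalar_prod_def numeral_2_eq_2 0 1)
       (simp add: bloch_def complex_eq_iff field_simps power2_eq_square)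
qed

text \<open>The smaller eigenvalue is \<open>(t - r) / 2\<close>. Necessity tests the form on its
  eigenvector, sufficiency is the Cauchy-Schwarz inequality for Bloch vectors.\<close>

lemma psd_bloch_iff:
  assumes "x\<^sup>2 + y\<^sup>2 + z\<^sup>2 = 1" "r \<ge> 0"
  shows "psd (bloch t (r * x) (r * y) (r * z)) \<longleftrightarrow> r \<le> t"
proof
  assume *: "psd (bloch t (r * x) (r * y) (r * z))"
  \<comment> \<open>The spinor of the opposite direction belongs to the smaller eigenvalue.\<close>
  obtain a u w where 1: "a\<^sup>2 + u\<^sup>2 + w\<^sup>2 = 1" and x: "- x = 2 * a * u" "- y = 2 * a * w" "- z = a\<^sup>2 - u\<^sup>2 - w\<^sup>2"
    using ex_spinor[of "-x" "-y" "-z"] assms unfolding power2_minus by blast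
  define v where "v = vec 2 (\<lambda>i. if i = 0 then complex_of_real a else Complex u w)"
  have v: "v \<in> carrier_vec 2" "v $ 0 = complex_of_real a" "v $ 1 = Complex u w"
    by (simp_all add: v_def)
  have "0 \<le> (bloch t (r * x) (r * y) (r * z) *\<^sub>v v) \<bullet>c v"
    using * v(1) by (simp add: psd_def)
  hence "0 \<le> t * (a\<^sup>2 + (u\<^sup>2 + w\<^sup>2)) + r * z * (a\<^sup>2 - (u\<^sup>2 + w\<^sup>2)) + r * x * (2 * (a * u)) + r * y * (2 * (a * w))"
    unfolding bloch_quadratic_form[OF v(1)] v(2,3)
    by (simp add: cmod_power2 less_eq_complex_def)
  also have "\<dots> = t * 1 + r * z * - z + r * x * - x + r * y * - y"
  proof -
    have "a\<^sup>2 + (u\<^sup>2 + w\<^sup>2) = 1" "a\<^sup>2 - (u\<^sup>2 + w\<^sup>2) = - z" "2 * (a * u) = - x" "2 * (a * w) = - y"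
      using 1 x by simp_all
    thus ?thesis by (simp only:)
  qed
  also have "\<dots> = t - r * (x\<^sup>2 + y\<^sup>2 + z\<^sup>2)"
    by (simp add: power2_eq_square algebra_simps)
  finally show "r \<le> t" using assms by simp
next
  assume r: "r \<le> t"
  have "hermitian (bloch t (r * x) (r * y) (r * z))"
    unfolding hermitian_def
    by (auto intro!: eq_matI elim!: less_two_cases simp: numeral_2_eq_2)
       (auto simp: bloch_def complex_eq_iff)
  moreover have "0 \<le> (bloch t (r * x) (r * y) (r * z) *\<^sub>v v) \<bullet>c v" if v: "v \<in> carrier_vec 2" for v
  proof -
    define N where "N = (cmod (v $ 0))\<^sup>2 + (cmod (v $ 1))\<^sup>2"
    define D where "D = (cmod (v $ 0))\<^sup>2 - (cmod (v $ 1))\<^sup>2"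
    define c where "c = 2 * Re (cnj (v $ 0) * v $ 1)"
    define s where "s = 2 * Im (cnj (v $ 0) * v $ 1)"
    \<comment> \<open>The Bloch vector \<open>(c, s, D)\<close> of \<open>v\<close> has length
      \<open>N\<close>. Lagrange's identity then bounds its product with the unit vector
      \<open>(x, y, z)\<close> by \<open>N\<close> in absolute value.\<close>
    have "N\<^sup>2 = c\<^sup>2 + s\<^sup>2 + D\<^sup>2"
      unfolding N_def D_def c_def s_def cmod_power2 times_complex.sel cnj.sel
      by (simp add: power2_eq_square algebra_simps)
    moreover have "(x * c + y * s + z * D)\<^sup>2 \<le> (x\<^sup>2 + y\<^sup>2 + z\<^sup>2) * (c\<^sup>2 + s\<^sup>2 + D\<^sup>2)"
    proof -
      have "(x\<^sup>2 + y\<^sup>2 + z\<^sup>2) * (c\<^sup>2 + s\<^sup>2 + D\<^sup>2) - (x * c + y * s + z * D)\<^sup>2 =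
        (x * s - y * c)\<^sup>2 + (x * D - z * c)\<^sup>2 + (y * D - z * s)\<^sup>2"
        by (simp add: power2_eq_square algebra_simps)
      thus ?thesis by (smt (verit) zero_le_power2)
    qed
    ultimately have "(x * c + y * s + z * D)\<^sup>2 \<le> N\<^sup>2" using assms by simp
    moreover have N: "N \<ge> 0" by (simp add: N_def)
    ultimately have "- N \<le> x * c + y * s + z * D"
      by (metis abs_le_iff abs_le_square_iff abs_of_nonneg minus_le_iff)
    hence "r * - N \<le> r * (x * c + y * s + z * D)" using assms by (intro mult_left_mono)
    moreover have "r * N \<le> t * N" using r N by (intro mult_right_mono)
    ultimately have "0 \<le> t * N + r * z * D + r * x * c + r * y * s"
      by (simp add: algebra_simps)
    thus ?thesis unfolding bloch_quadratic_form[OF v] N_def D_def c_def s_def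
      by (simp add: less_eq_complex_def)
  qed
  ultimately show "psd (bloch t (r * x) (r * y) (r * z))" by (simp add: psd_def)
qed

section \<open>Binary entropy\<close>

text \<open>Only the point 0 is delicate. There \<open>ln (1 / q) \<le> 1 / q - 1\<close> with
  \<open>q = sqrt \<bar>h\<bar>\<close> bounds \<open>h * ln h\<close> by a multiple of
  \<open>q\<close>.\<close>

lemma isCont_mult_log: "isCont (\<lambda>t. t * log 2 t) (t :: real)"
proof (cases "t = 0")
  case True
  have *: "\<bar>h * ln h\<bar> \<le> 2 * sqrt \<bar>h\<bar>" if h: "\<bar>h\<bar> < 1" for h :: real
  proof (cases "h = 0")
    case False
    define q where "q = sqrt \<bar>h\<bar>"
    have q: "0 < q" "q < 1" "\<bar>h\<bar> = q * q" using h False by (simp_all add: q_def)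
    have "ln (1 / q) \<le> 1 / q - 1" using q by (intro ln_le_minus_one) simp
    moreover have "ln (1 / q) = - ln q" using q by (simp add: ln_div)
    ultimately have "- ln q \<le> 1 / q" by linarith
    hence 1: "q * - ln q \<le> q * (1 / q)" by (rule mult_left_mono) (use q in simp)
    \<comment> \<open>Continuity is two-sided, so negative \<open>h\<close> count too; for them
      \<open>ln h\<close> equals \<open>ln \<bar>h\<bar>\<close>.\<close>
    have "ln h = ln (q * q)" using q(3) by (metis abs_if ln_minus)
    hence "\<bar>h * ln h\<bar> = q * q * (2 * - ln q)"
      unfolding abs_mult q(3) using q by (simp add: ln_mult)
    also have "\<dots> = 2 * q * (q * - ln q)" by simp
    also have "\<dots> \<le> 2 * q * (q * (1 / q))" using q by (intro mult_left_mono[OF 1]) simp_all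
    finally have "\<bar>h * ln h\<bar> \<le> 2 * q" using q(1) by simp
    thus ?thesis by (simp only: q_def)
  qed simp
  have "((\<lambda>h::real. h * ln h) \<longlongrightarrow> 0) (at 0)"
  proof (rule tendsto_0_le[where K = 1])
    show "\<forall>\<^sub>F h::real in at 0. norm (h * ln h) \<le> norm (2 * sqrt \<bar>h\<bar>) * 1"
      unfolding eventually_at by (rule exI[of _ 1]) (use * in auto)
    have "((\<lambda>h::real. 2 * sqrt \<bar>h\<bar>) \<longlongrightarrow> 2 * sqrt \<bar>0\<bar>) (at 0)"
      by (intro tendsto_intros)
    thus "((\<lambda>h::real. 2 * sqrt \<bar>h\<bar>) \<longlongrightarrow> 0) (at 0)" by simp
  qed
  from tendsto_divide[OF this tendsto_const, of "ln 2"] show ?thesis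
    unfolding isCont_def log_def by (simp add: True)
next
  case False
  thus ?thesis unfolding log_def by (intro continuous_intros) simp_all
qed

lemma isCont_H2: "isCont H2 t"
proof -
  have "isCont (\<lambda>t. (1 - t) * log 2 (1 - t)) t"
    by (rule isCont_o2[where f = "\<lambda>t. 1 - t" and g = "\<lambda>t. t * log 2 t", OF _ isCont_mult_log]) simp
  hence "isCont (\<lambda>t. - (t * log 2 t) - (1 - t) * log 2 (1 - t)) t"
    by (intro isCont_diff isCont_minus isCont_mult_log)
  thus ?thesis unfolding H2_def[abs_def] by simp
qed

text \<open>The derivative is the logarithm of \<open>(1 - u) / u\<close>, nonnegative up to 1/2. It
  blows up at 0, hence the criterion with derivatives in the interior and mere continuity at the
  ends.\<close>

lemma H2_mono:
  assumes "0 \<le> s" "s \<le> t" "t \<le> 1/2"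
  shows "H2 s \<le> H2 t"
proof (rule DERIV_nonneg_imp_increasing_open[of s t H2])
  fix u assume u: "s < u" "u < t"
  have "((\<lambda>t. t * ln t + (1 - t) * ln (1 - t)) has_real_derivative ln u - ln (1 - u)) (at u)"
    using u assms by (auto intro!: derivative_eq_intros)
  from DERIV_cdivide[OF DERIV_minus[OF this], of "ln 2"]
  have "(H2 has_real_derivative log 2 (1 - u) - log 2 u) (at u)"
    unfolding H2_def[abs_def] log_def by (simp add: diff_divide_distrib add_divide_distrib)
  moreover have "log 2 u \<le> log 2 (1 - u)" using u assms by simp
  ultimately show "\<exists>y. (H2 has_real_derivative y) (at u) \<and> 0 \<le> y" by force
qed (use assms in \<open>auto intro!: continuous_at_imp_continuous_on isCont_H2\<close>)

lemma H2_symmetric: "H2 (1 - t) = H2 t"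
  by (simp add: H2_def algebra_simps)

lemma H2_nonneg: "0 \<le> t \<Longrightarrow> t \<le> 1/2 \<Longrightarrow> 0 \<le> H2 t"
  using H2_mono[of 0 t] by (simp add: H2_def)

text \<open>The grouping rule for entropy: the eigenvalues of a matrix of trace \<open>s\<close> are
  \<open>s\<close> times a binary distribution. The degenerate cases rest on
  \<open>log 2 0 = 0\<close>.\<close>

lemma H2_scaled:
  assumes "0 \<le> s" "0 \<le> e" "e < 1"
  shows "s * (1 - e) * log 2 (s * (1 - e)) + s * e * log 2 (s * e) = s * log 2 s - s * H2 e"
proof (cases "s = 0 \<or> e = 0")
  case True
  thus ?thesis by (auto simp: H2_def)
next
  case False
  hence "log 2 (s * (1 - e)) = log 2 s + log 2 (1 - e)" "log 2 (s * e) = log 2 s + log 2 e"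
    using assms by (simp_all add: log_mult)
  thus ?thesis by (simp only: H2_def) (simp add: algebra_simps)
qed

text \<open>Mutual approximation from above suffices, as needed for pairs that are only limits of
  parameter points. Nonemptiness and boundedness pass from \<open>T\<close> to \<open>S\<close>, so
  they are checked on one side only.\<close>

lemma Inf_eq_if_approx:
  fixes S T :: "real set"
  assumes "T \<noteq> {}" "bdd_below T"
    and ST: "\<And>s e. s \<in> S \<Longrightarrow> e > 0 \<Longrightarrow> \<exists>t\<in>T. t < s + e"
    and TS: "\<And>t e. t \<in> T \<Longrightarrow> e > 0 \<Longrightarrow> \<exists>s\<in>S. s < t + e"
  shows "Inf S = Inf T"
proof -
  have le: "Inf T \<le> s" if "s \<in> S" for s
  proof (rule field_le_epsilon)
    fix e :: real assume "e > 0"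
    with ST[OF that] obtain t where "t \<in> T" "t < s + e" by blast
    thus "Inf T \<le> s + e" using cInf_lower[OF _ assms(2)] by force
  qed
  hence bdd: "bdd_below S" by (auto simp: bdd_below_def)
  have ne: "S \<noteq> {}" using TS[of _ 1] assms(1) by fastforce
  have "Inf S \<le> t" if "t \<in> T" for t
  proof (rule field_le_epsilon)
    fix e :: real assume "e > 0"
    with TS[OF that] obtain s where "s \<in> S" "s < t + e" by blast
    thus "Inf S \<le> t + e" using cInf_lower[OF _ bdd] by force
  qed
  with le show ?thesis
    by (intro antisym cInf_greatest assms(1) ne)
qed

section \<open>Entropy and overlap of a pair of size two\<close>

lemma entropy_bloch:
  assumes "x\<^sup>2 + y\<^sup>2 + z\<^sup>2 = 1"
  shows "entropy (bloch t (r * x) (r * y) (r * z)) =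
    - ((t + r) / 2 * log 2 ((t + r) / 2) + (t - r) / 2 * log 2 ((t - r) / 2))"
proof -
  define p q where "p = log 2 ((t + r) / 2)" and "q = log 2 ((t - r) / 2)"
  have "r * x * ((p - q) * x) + r * y * ((p - q) * y) + r * z * ((p - q) * z) = r * (p - q) * (x\<^sup>2 + y\<^sup>2 + z\<^sup>2)"
    by (simp add: power2_eq_square algebra_simps)
  hence *: "t * (p + q) + r * x * ((p - q) * x) + r * y * ((p - q) * y) + r * z * ((p - q) * z)
      = (t + r) * p + (t - r) * q"
    unfolding assms by (simp add: algebra_simps)
  show ?thesis
    unfolding entropy_def herm_fun_bloch[OF assms] Let_def p_def[symmetric] q_def[symmetric] trace_bloch_mult *
    by (simp add: add_divide_distrib)
qed

text \<open>\<open>Gamma_HC\<close> with \<open>P\<close> as an independent argument: \<open>P_HC\<close> is \<open>0\<close>, as a division by \<open>0\<close>, when a matrix is scalar.\<close>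

definition overlap_HC :: "real \<Rightarrow> real \<Rightarrow> real \<Rightarrow> real \<Rightarrow> real" where
  "overlap_HC x \<eta> \<rho> P = 2 * sqrt (x * (1 - x)) *
     (P * (sqrt ((1 - \<eta>) * (1 - \<rho>)) + sqrt (\<eta> * \<rho>)) +
      (1 - P) * (sqrt (\<rho> * (1 - \<eta>)) + sqrt (\<eta> * (1 - \<rho>))))"

lemma Gamma_ch_bloch:
  assumes "a1\<^sup>2 + a2\<^sup>2 + a3\<^sup>2 = 1" "b1\<^sup>2 + b2\<^sup>2 + b3\<^sup>2 = 1"
  shows "Gamma_ch (bloch s (q * a1) (q * a2) (q * a3)) (bloch t (r * b1) (r * b2) (r * b3)) =
    (let f = sqrt ((s + q) / 2); f' = sqrt ((s - q) / 2); g = sqrt ((t + r) / 2); g' = sqrt ((t - r) / 2)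
     in (f + f') * (g + g') + (f - f') * (g - g') * (a1 * b1 + a2 * b2 + a3 * b3))"
proof -
  define f f' g g' where "f = sqrt ((s + q) / 2)" and "f' = sqrt ((s - q) / 2)"
    and "g = sqrt ((t + r) / 2)" and "g' = sqrt ((t - r) / 2)"
  note d = this[symmetric]
  show ?thesis
    unfolding Gamma_ch_def herm_fun_bloch[OF assms(1)] herm_fun_bloch[OF assms(2)] Let_def trace_bloch_mult d
    by (simp add: field_simps)
qed

lemma bloch_add:
  "bloch s a1 a2 a3 + bloch t b1 b2 b3 = bloch (s + t) (a1 + b1) (a2 + b2) (a3 + b3)"
  by (rule eq_matI) (auto simp: bloch_def complex_eq_iff field_simps)

text \<open>The law of cosines with cosine \<open>2 * P - 1\<close>, arranged so that solving for
  \<open>P\<close> gives the formula of \<open>P_HC\<close>.\<close>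

lemma bloch_cosine_rule:
  fixes q r :: real
  assumes "a1\<^sup>2 + a2\<^sup>2 + a3\<^sup>2 = 1" "b1\<^sup>2 + b2\<^sup>2 + b3\<^sup>2 = 1"
  shows "(q * a1 + r * b1)\<^sup>2 + (q * a2 + r * b2)\<^sup>2 + (q * a3 + r * b3)\<^sup>2
    = (q - r)\<^sup>2 + 4 * q * r * ((1 + (a1 * b1 + a2 * b2 + a3 * b3)) / 2)"
proof -
  have "(q * a1 + r * b1)\<^sup>2 + (q * a2 + r * b2)\<^sup>2 + (q * a3 + r * b3)\<^sup>2 =
     q\<^sup>2 * (a1\<^sup>2 + a2\<^sup>2 + a3\<^sup>2) + r\<^sup>2 * (b1\<^sup>2 + b2\<^sup>2 + b3\<^sup>2) + 2 * q * r * (a1 * b1 + a2 * b2 + a3 * b3)"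
    by (simp add: power2_eq_square algebra_simps)
  thus ?thesis unfolding assms by (simp add: power2_eq_square field_simps)
qed

text \<open>The dictionary between matrices and parameters, used in both directions. The relation
  between \<open>E_HC z\<close> and \<open>P\<close> is free of division, so scalar matrices are
  included; \<open>z \<le> 1/2\<close> makes \<open>E_HC z\<close> the nonnegative root.\<close>

lemma bloch_pair:
  assumes a: "a1\<^sup>2 + a2\<^sup>2 + a3\<^sup>2 = 1" and b: "b1\<^sup>2 + b2\<^sup>2 + b3\<^sup>2 = 1"
    and x: "0 \<le> x" "x \<le> 1" and \<eta>: "0 \<le> \<eta>" "\<eta> < 1" and \<rho>: "0 \<le> \<rho>" "\<rho> < 1" and z: "z \<le> 1/2"
    and A: "A = A_HC x \<eta>" and B: "B = B_HC x \<rho>" and P: "P = (1 + (a1 * b1 + a2 * b2 + a3 * b3)) / 2"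
    and E: "(E_HC z)\<^sup>2 = (A - B)\<^sup>2 + 4 * A * B * P"
    and K: "K = bloch (1 - x) (A * a1) (A * a2) (A * a3)"
    and L: "L = bloch x (B * b1) (B * b2) (B * b3)"
  shows "Phi_ch K L = Phi_HC x \<eta> \<rho> z" "Gamma_ch K L = overlap_HC x \<eta> \<rho> P"
proof -
  \<comment> \<open>The eigenvalues of \<open>K\<close>, of \<open>L\<close> and of
    \<open>K + L\<close>.\<close>
  have A': "(1 - x + A) / 2 = (1 - x) * (1 - \<eta>)" "(1 - x - A) / 2 = (1 - x) * \<eta>"
    and B': "(x + B) / 2 = x * (1 - \<rho>)" "(x - B) / 2 = x * \<rho>"
    and E': "(1 + E_HC z) / 2 = 1 - z" "(1 - E_HC z) / 2 = z"
    by (simp_all add: A B A_HC_def B_HC_def E_HC_def field_simps)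
  obtain R c1 c2 c3 where c: "R \<ge> 0" "c1\<^sup>2 + c2\<^sup>2 + c3\<^sup>2 = 1"
    "A * a1 + B * b1 = R * c1" "A * a2 + B * b2 = R * c2" "A * a3 + B * b3 = R * c3"
    using ex_direction by metis
  have "R\<^sup>2 = R\<^sup>2 * (c1\<^sup>2 + c2\<^sup>2 + c3\<^sup>2)" unfolding c(2) by simp
  also have "\<dots> = (R * c1)\<^sup>2 + (R * c2)\<^sup>2 + (R * c3)\<^sup>2"
    by (simp add: power_mult_distrib algebra_simps)
  also have "\<dots> = (E_HC z)\<^sup>2"
    unfolding c(3-5)[symmetric] bloch_cosine_rule[OF a b] E P ..
  finally have "R = E_HC z" using c(1) z by (simp add: E_HC_def)
  hence KL: "K + L = bloch 1 (E_HC z * c1) (E_HC z * c2) (E_HC z * c3)"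
    by (simp add: K L bloch_add c)
  show "Phi_ch K L = Phi_HC x \<eta> \<rho> z"
    using H2_scaled[of "1 - x" \<eta>] H2_scaled[of x \<rho>] x \<eta> \<rho>
    unfolding Phi_ch_def KL unfolding K L entropy_bloch[OF a] entropy_bloch[OF b] entropy_bloch[OF c(2)] A' B' E'
    by (simp add: Phi_HC_def H2_def[of x] H2_def[of z])
  define f f' g g' where f: "f = sqrt ((1 - x) * (1 - \<eta>))" and f': "f' = sqrt ((1 - x) * \<eta>)"
    and g: "g = sqrt (x * (1 - \<rho>))" and g': "g' = sqrt (x * \<rho>)"
  have "a1 * b1 + a2 * b2 + a3 * b3 = 2 * P - 1" by (simp add: P field_simps)
  hence "Gamma_ch K L = (f + f') * (g + g') + (f - f') * (g - g') * (2 * P - 1)"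
    unfolding K L Gamma_ch_bloch[OF a b] A' B' Let_def f f' g g' by simp
  \<comment> \<open>Eigenvectors of like rank overlap with weight \<open>P\<close>, those of
    opposite rank with weight \<open>1 - P\<close>.\<close>
  also have "\<dots> = 2 * (P * (f * g + f' * g') + (1 - P) * (f * g' + f' * g))"
    by (simp add: algebra_simps)
  also have "f * g = sqrt (x * (1 - x)) * sqrt ((1 - \<eta>) * (1 - \<rho>))"
    by (simp add: f g real_sqrt_mult)
  also have "f' * g' = sqrt (x * (1 - x)) * sqrt (\<eta> * \<rho>)"
    by (simp add: f' g' real_sqrt_mult)
  also have "f * g' = sqrt (x * (1 - x)) * sqrt (\<rho> * (1 - \<eta>))"
    by (simp add: f g' real_sqrt_mult)
  also have "f' * g = sqrt (x * (1 - x)) * sqrt (\<eta> * (1 - \<rho>))"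
    by (simp add: f' g real_sqrt_mult)
  finally show "Gamma_ch K L = overlap_HC x \<eta> \<rho> P"
    by (simp add: overlap_HC_def algebra_simps)
qed

section \<open>From the four parameters to pairs of matrices\<close>

lemma HC_angle:
  assumes "(x, \<eta>, \<rho>, z) \<in> D_HC"
  shows "0 < A_HC x \<eta>" "0 < B_HC x \<rho>" "0 \<le> P_HC x \<eta> \<rho> z" "P_HC x \<eta> \<rho> z \<le> 1"
    "(E_HC z)\<^sup>2 = (A_HC x \<eta> - B_HC x \<rho>)\<^sup>2 + 4 * A_HC x \<eta> * B_HC x \<rho> * P_HC x \<eta> \<rho> z"
proof -
  have x: "0 < x" "x \<le> 1/2" "0 \<le> \<eta>" "\<eta> < 1/2" "0 \<le> \<rho>" "\<rho> < 1/2" "0 \<le> z" "z \<le> 1/2"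
     "\<bar>A_HC x \<eta> - B_HC x \<rho>\<bar> \<le> E_HC z" "E_HC z \<le> A_HC x \<eta> + B_HC x \<rho>"
    using assms by (auto simp: D_HC_def)
  show AB: "0 < A_HC x \<eta>" "0 < B_HC x \<rho>" using x by (simp_all add: A_HC_def B_HC_def)
  show "(E_HC z)\<^sup>2 = (A_HC x \<eta> - B_HC x \<rho>)\<^sup>2 + 4 * A_HC x \<eta> * B_HC x \<rho> * P_HC x \<eta> \<rho> z"
    using AB by (simp add: P_HC_def)
  have "(A_HC x \<eta> - B_HC x \<rho>)\<^sup>2 \<le> (E_HC z)\<^sup>2"
    using x(9) by (metis abs_ge_zero power2_abs power_mono)
  thus "0 \<le> P_HC x \<eta> \<rho> z" using AB by (simp add: P_HC_def)
  have "0 \<le> E_HC z" using x by (simp add: E_HC_def)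
  hence "(E_HC z)\<^sup>2 \<le> (A_HC x \<eta> + B_HC x \<rho>)\<^sup>2" using x by (intro power_mono)
  hence "(E_HC z)\<^sup>2 - (A_HC x \<eta> - B_HC x \<rho>)\<^sup>2 \<le> 4 * A_HC x \<eta> * B_HC x \<rho>"
    by (simp add: power2_eq_square algebra_simps)
  thus "P_HC x \<eta> \<rho> z \<le> 1" using AB by (simp add: P_HC_def)
qed

lemma Gamma_HC_eq: "Gamma_HC x \<eta> \<rho> z = overlap_HC x \<eta> \<rho> (P_HC x \<eta> \<rho> z)"
  by (simp add: Gamma_HC_def overlap_HC_def)

lemma bloch_trace: "mat_trace (bloch t x y z) = complex_of_real t"
  by (simp add: mat_trace_def numeral_2_eq_2) (simp add: bloch_def complex_eq_iff field_simps)

text \<open>Put the vector of \<open>K\<close> on the third axis and that of \<open>L\<close> in the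
  plane of the first and third axes, at the angle with cosine \<open>2 * P - 1\<close>. By the
  triangle inequalities in \<open>D_HC\<close> this cosine lies between -1 and 1.\<close>

lemma HC_realized_by_matrices:
  assumes "(x, \<eta>, \<rho>, z) \<in> D_HC"
  shows "\<exists>K L. (K, L) \<in> K_pairs 2 \<and> Phi_ch K L = Phi_HC x \<eta> \<rho> z \<and> Gamma_ch K L = Gamma_HC x \<eta> \<rho> z"
proof -
  have x: "0 < x" "x \<le> 1/2" "0 \<le> \<eta>" "\<eta> < 1/2" "0 \<le> \<rho>" "\<rho> < 1/2" "z \<le> 1/2"
    using assms by (auto simp: D_HC_def)
  define c where "c = 2 * P_HC x \<eta> \<rho> z - 1"
  define s where "s = sqrt (1 - c\<^sup>2)"
  have "\<bar>c\<bar> \<le> 1" using HC_angle[OF assms] by (simp add: c_def)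
  hence "c\<^sup>2 \<le> 1" by (simp add: abs_square_le_1)
  hence b: "s\<^sup>2 + 0\<^sup>2 + c\<^sup>2 = 1" by (simp add: s_def)
  have a: "0\<^sup>2 + 0\<^sup>2 + 1\<^sup>2 = (1::real)" by simp
  define K where "K = bloch (1 - x) (A_HC x \<eta> * 0) (A_HC x \<eta> * 0) (A_HC x \<eta> * 1)"
  define L where "L = bloch x (B_HC x \<rho> * s) (B_HC x \<rho> * 0) (B_HC x \<rho> * c)"
  have P: "P_HC x \<eta> \<rho> z = (1 + (0 * s + 0 * 0 + 1 * c)) / 2" by (simp add: c_def)
  have r: "0 \<le> x" "x \<le> 1" "\<eta> < 1" "\<rho> < 1" using x by simp_all
  note 1 = bloch_pair[OF a b r(1,2) x(3) r(3) x(5) r(4) x(7) refl refl P HC_angle(5)[OF assms] K_def L_def]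
  have "psd K" unfolding K_def
    using HC_angle(1)[OF assms] x
    by (subst psd_bloch_iff[OF a]) (auto simp: A_HC_def intro!: mult_left_le)
  moreover have "psd L" unfolding L_def
    using HC_angle(2)[OF assms] x
    by (subst psd_bloch_iff[OF b]) (auto simp: B_HC_def intro!: mult_left_le)
  moreover have "mat_trace (K + L) = 1" by (simp add: K_def L_def bloch_add bloch_trace)
  ultimately have "(K, L) \<in> K_pairs 2" by (simp add: K_pairs_def) (simp add: K_def L_def)
  thus ?thesis using 1 unfolding Gamma_HC_eq by blast
qed

section \<open>From pairs of matrices to the four parameters\<close>

lemma K_pairs_commute:
  assumes "(K, L) \<in> K_pairs 2"
  shows "(L, K) \<in> K_pairs 2" "Phi_ch L K = Phi_ch K L" "Gamma_ch L K = Gamma_ch K L"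
proof -
  have c: "K \<in> carrier_mat 2 2" "L \<in> carrier_mat 2 2" "psd K" "psd L" using assms by (auto simp: K_pairs_def)
  have add: "L + K = K + L" using c by (metis comm_add_mat)
  thus "(L, K) \<in> K_pairs 2" "Phi_ch L K = Phi_ch K L" using assms by (auto simp: K_pairs_def Phi_ch_def)
  obtain s q a1 a2 a3 where a: "a1\<^sup>2 + a2\<^sup>2 + a3\<^sup>2 = 1" "K = bloch s (q * a1) (q * a2) (q * a3)"
    using hermitian_eq_bloch[of K] c by (auto simp: psd_def)
  obtain t r b1 b2 b3 where b: "b1\<^sup>2 + b2\<^sup>2 + b3\<^sup>2 = 1" "L = bloch t (r * b1) (r * b2) (r * b3)"
    using hermitian_eq_bloch[of L] c by (auto simp: psd_def)
  show "Gamma_ch L K = Gamma_ch K L"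
    unfolding a(2) b(2) Gamma_ch_bloch[OF a(1) b(1)] Gamma_ch_bloch[OF b(1) a(1)]
    by (simp add: Let_def mult_ac)
qed

text \<open>The bounds on \<open>\<eta>\<close> and \<open>\<rho>\<close> are closed here, and
  \<open>P\<close> is a separate witness, because a scalar matrix leaves the angle undetermined by
  the lengths.\<close>

lemma K_pairs_reduction_ordered:
  assumes KL: "(K, L) \<in> K_pairs 2" and \<Gamma>: "0 < Gamma_ch K L" and tr: "Re (mat_trace L) \<le> 1/2"
  shows "\<exists>x \<eta> \<rho> z P. 0 < x \<and> x \<le> 1/2 \<and> 0 \<le> \<eta> \<and> \<eta> \<le> 1/2 \<and> 0 \<le> \<rho> \<and> \<rho> \<le> 1/2 \<and> 0 \<le> z \<and> z \<le> 1/2 \<and>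
     0 \<le> P \<and> P \<le> 1 \<and>
     (E_HC z)\<^sup>2 = (A_HC x \<eta> - B_HC x \<rho>)\<^sup>2 + 4 * A_HC x \<eta> * B_HC x \<rho> * P \<and>
     Phi_ch K L = Phi_HC x \<eta> \<rho> z \<and> Gamma_ch K L = overlap_HC x \<eta> \<rho> P"
proof -
  have c: "K \<in> carrier_mat 2 2" "L \<in> carrier_mat 2 2" "psd K" "psd L" "mat_trace (K + L) = 1"
    using KL by (auto simp: K_pairs_def)
  obtain s q a1 a2 a3 where a: "a1\<^sup>2 + a2\<^sup>2 + a3\<^sup>2 = 1" and K: "K = bloch s (q * a1) (q * a2) (q * a3)" and q: "0 \<le> q"
    using hermitian_eq_bloch[of K] c by (auto simp: psd_def)
  obtain x r b1 b2 b3 where b: "b1\<^sup>2 + b2\<^sup>2 + b3\<^sup>2 = 1" and L: "L = bloch x (r * b1) (r * b2) (r * b3)" and r: "0 \<le> r"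
    using hermitian_eq_bloch[of L] c by (auto simp: psd_def)
  have "complex_of_real (s + x) = 1" using c(5) unfolding K L bloch_add bloch_trace .
  hence s: "s = 1 - x" by (simp add: complex_eq_iff)
  have qs: "q \<le> 1 - x" and rx: "r \<le> x"
    using c(3,4) psd_bloch_iff[OF a q] psd_bloch_iff[OF b r] by (simp_all add: K L s)
  have x2: "x \<le> 1/2" using tr by (simp add: L bloch_trace)
  \<comment> \<open>A pair with \<open>L = 0\<close> has overlap 0, which the hypothesis on
    \<open>Gamma_ch\<close> excludes.\<close>
  have "x \<noteq> 0"
  proof
    assume "x = 0"
    with rx r have "r = 0" by simp
    with \<open>x = 0\<close> \<Gamma> show False unfolding K L Gamma_ch_bloch[OF a b] by (simp add: Let_def)
  qed
  with rx r have x: "0 < x" by simp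
  \<comment> \<open>The smaller eigenvalue of each matrix as a fraction of its trace.\<close>
  define \<eta> where "\<eta> = (1 - q / (1 - x)) / 2"
  define \<rho> where "\<rho> = (1 - r / x) / 2"
  have \<eta>: "0 \<le> \<eta>" "\<eta> \<le> 1/2" "q = A_HC x \<eta>"
    using qs q x2 by (simp_all add: \<eta>_def A_HC_def field_simps)
  have \<rho>: "0 \<le> \<rho>" "\<rho> \<le> 1/2" "r = B_HC x \<rho>"
    using rx r x by (simp_all add: \<rho>_def B_HC_def field_simps)
  define \<gamma> where "\<gamma> = a1 * b1 + a2 * b2 + a3 * b3"
  define P where "P = (1 + \<gamma>) / 2"
  \<comment> \<open>The squared lengths of the difference and the sum of the unit vectors give the
    two bounds on \<open>P\<close>.\<close>
  have "0 \<le> (a1 - b1)\<^sup>2 + (a2 - b2)\<^sup>2 + (a3 - b3)\<^sup>2" by simp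
  also have "\<dots> = (a1\<^sup>2 + a2\<^sup>2 + a3\<^sup>2) + (b1\<^sup>2 + b2\<^sup>2 + b3\<^sup>2) - 2 * \<gamma>"
    by (simp add: \<gamma>_def power2_eq_square algebra_simps)
  finally have P1: "P \<le> 1" unfolding a b by (simp add: P_def)
  have "0 \<le> (a1 + b1)\<^sup>2 + (a2 + b2)\<^sup>2 + (a3 + b3)\<^sup>2" by simp
  also have "\<dots> = (a1\<^sup>2 + a2\<^sup>2 + a3\<^sup>2) + (b1\<^sup>2 + b2\<^sup>2 + b3\<^sup>2) + 2 * \<gamma>"
    by (simp add: \<gamma>_def power2_eq_square algebra_simps)
  finally have P0: "0 \<le> P" unfolding a b by (simp add: P_def)
  define E where "E = sqrt ((q - r)\<^sup>2 + 4 * q * r * P)"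
  have E: "0 \<le> E" "E\<^sup>2 = (q - r)\<^sup>2 + 4 * q * r * P"
    using P0 q r by (simp_all add: E_def)
  have "E\<^sup>2 \<le> (q - r)\<^sup>2 + 4 * q * r * 1"
    unfolding E(2) using P1 q r by (intro add_left_mono mult_left_mono) simp_all
  also have "\<dots> = (q + r)\<^sup>2" by (simp add: power2_eq_square algebra_simps)
  \<comment> \<open>Positivity bounds each length by the trace, and the traces add up to 1.\<close>
  also have "\<dots> \<le> 1\<^sup>2" using q r qs rx by (intro power_mono) simp_all
  finally have "E \<le> 1" using power2_le_imp_le[of E 1] by simp
  define z where "z = (1 - E) / 2"
  have z: "0 \<le> z" "z \<le> 1/2" "E_HC z = E" using E \<open>E \<le> 1\<close> by (simp_all add: z_def E_HC_def field_simps)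
  have Ez: "(E_HC z)\<^sup>2 = (q - r)\<^sup>2 + 4 * q * r * P" unfolding z(3) by (rule E)
  have r: "0 \<le> x" "x \<le> 1" "\<eta> < 1" "\<rho> < 1" using x x2 \<eta>(2) \<rho>(2) by simp_all
  note bloch_pair[OF a b r(1,2) \<eta>(1) r(3) \<rho>(1) r(4) z(2) \<eta>(3) \<rho>(3) P_def[unfolded \<gamma>_def] Ez K[unfolded s] L]
  thus ?thesis using x x2 \<eta>(1,2) \<rho>(1,2) z(1,2) P0 P1 Ez unfolding \<eta>(3) \<rho>(3)
    by (intro exI[of _ x] exI[of _ \<eta>] exI[of _ \<rho>] exI[of _ z] exI[of _ P] conjI)
qed

lemma K_pairs_reduction:
  assumes KL: "(K, L) \<in> K_pairs 2" and \<Gamma>: "0 < Gamma_ch K L"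
  shows "\<exists>x \<eta> \<rho> z P. 0 < x \<and> x \<le> 1/2 \<and> 0 \<le> \<eta> \<and> \<eta> \<le> 1/2 \<and> 0 \<le> \<rho> \<and> \<rho> \<le> 1/2 \<and> 0 \<le> z \<and> z \<le> 1/2 \<and>
     0 \<le> P \<and> P \<le> 1 \<and>
     (E_HC z)\<^sup>2 = (A_HC x \<eta> - B_HC x \<rho>)\<^sup>2 + 4 * A_HC x \<eta> * B_HC x \<rho> * P \<and>
     Phi_ch K L = Phi_HC x \<eta> \<rho> z \<and> Gamma_ch K L = overlap_HC x \<eta> \<rho> P"
proof (cases "Re (mat_trace L) \<le> 1/2")
  case True
  thus ?thesis using K_pairs_reduction_ordered[OF KL \<Gamma>] by blast
next
  case False
  have c: "K \<in> carrier_mat 2 2" "L \<in> carrier_mat 2 2" "mat_trace (K + L) = 1"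
    using KL by (auto simp: K_pairs_def)
  hence "mat_trace K + mat_trace L = 1" by (simp add: mat_trace_def sum.distrib)
  hence "Re (mat_trace K) + Re (mat_trace L) = 1" by (simp add: complex_eq_iff)
  with False have "Re (mat_trace K) \<le> 1/2" by simp
  note K_pairs_reduction_ordered[OF K_pairs_commute(1)[OF KL], unfolded K_pairs_commute(2,3)[OF KL], OF \<Gamma> this]
  thus ?thesis .
qed

text \<open>Moves \<open>\<eta>\<close> and \<open>\<rho>\<close> slightly below \<open>1/2\<close> while keeping the two vectors parallel, so that \<open>P = 1\<close>.\<close>

lemma HC_near_boundary:
  assumes x: "0 < x" "x \<le> 1/2" and \<eta>: "0 \<le> \<eta>" "\<eta> \<le> 1/2" and \<rho>: "0 \<le> \<rho>" "\<rho> \<le> 1/2"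
    and z: "E_HC z = A_HC x \<eta> + B_HC x \<rho>"
    and g: "g < overlap_HC x \<eta> \<rho> 1" and e: "Phi_HC x \<eta> \<rho> z < e"
  shows "\<exists>\<eta>' \<rho>' z'. (x, \<eta>', \<rho>', z') \<in> D_HC \<and> g < Gamma_HC x \<eta>' \<rho>' z' \<and> Phi_HC x \<eta>' \<rho>' z' < e"
proof -
  \<comment> \<open>For \<open>h\<close> below 1/2 the minimum makes both parameters less than 1/2,
    and it tends to the old values as \<open>h\<close> tends to 1/2. The choice of \<open>z'\<close>
    forces \<open>E = A + B\<close>.\<close>
  define \<eta>' \<rho>' z' where "\<eta>' h = min \<eta> h" and "\<rho>' h = min \<rho> h"
    and "z' h = (1 - A_HC x (min \<eta> h) - B_HC x (min \<rho> h)) / 2" for h :: real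
  have "(\<eta>' \<longlongrightarrow> min \<eta> (1/2)) (at_left (1/2))" "(\<rho>' \<longlongrightarrow> min \<rho> (1/2)) (at_left (1/2))"
    unfolding \<eta>'_def[abs_def] \<rho>'_def[abs_def] by (intro tendsto_intros)+
  hence lim: "(\<eta>' \<longlongrightarrow> \<eta>) (at_left (1/2))" "(\<rho>' \<longlongrightarrow> \<rho>) (at_left (1/2))"
    using \<eta> \<rho> by (simp_all add: min_absorb1)
  have z_eq: "z = (1 - (1 - x) * (1 - 2 * \<eta>) - x * (1 - 2 * \<rho>)) / 2"
    using z by (simp add: E_HC_def A_HC_def B_HC_def)
  have "(z' \<longlongrightarrow> z) (at_left (1/2))"
    unfolding z'_def[abs_def] \<eta>'_def[symmetric] \<rho>'_def[symmetric] A_HC_def B_HC_def z_eq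
    by (intro tendsto_intros lim) simp_all
  note lim = lim this
  have "((\<lambda>h. overlap_HC x (\<eta>' h) (\<rho>' h) 1) \<longlongrightarrow> overlap_HC x \<eta> \<rho> 1) (at_left (1/2))"
    unfolding overlap_HC_def by (intro tendsto_intros lim)
  hence 1: "\<forall>\<^sub>F h in at_left (1/2). g < overlap_HC x (\<eta>' h) (\<rho>' h) 1"
    using g by (rule order_tendstoD)
  have "((\<lambda>h. Phi_HC x (\<eta>' h) (\<rho>' h) (z' h)) \<longlongrightarrow> Phi_HC x \<eta> \<rho> z) (at_left (1/2))"
    unfolding Phi_HC_def by (intro tendsto_intros isCont_tendsto_compose[OF isCont_H2] lim)
  hence 2: "\<forall>\<^sub>F h in at_left (1/2). Phi_HC x (\<eta>' h) (\<rho>' h) (z' h) < e"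
    using e by (rule order_tendstoD)
  have 3: "\<forall>\<^sub>F h in at_left (1/2::real). h \<in> {0<..<1/2}"
    by (rule eventually_at_left_real) simp
  obtain h where h: "0 < h" "h < 1/2" "g < overlap_HC x (\<eta>' h) (\<rho>' h) 1"
      "Phi_HC x (\<eta>' h) (\<rho>' h) (z' h) < e"
    using eventually_happens[OF eventually_conj[OF 1 eventually_conj[OF 2 3]]] by auto
  define A B where A: "A = A_HC x (\<eta>' h)" and B: "B = B_HC x (\<rho>' h)"
  have r: "0 \<le> \<eta>' h" "\<eta>' h < 1/2" "0 \<le> \<rho>' h" "\<rho>' h < 1/2"
    using h \<eta> \<rho> by (auto simp: \<eta>'_def \<rho>'_def)
  have AB: "0 < A" "A \<le> 1 - x" "0 < B" "B \<le> x"
    using r x by (auto simp: A B A_HC_def B_HC_def intro!: mult_left_le)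
  have E: "E_HC (z' h) = A + B" by (simp add: E_HC_def z'_def A B \<eta>'_def \<rho>'_def field_simps)
  hence "z' h = (1 - (A + B)) / 2" by (simp add: E_HC_def)
  hence "0 \<le> z' h" "z' h \<le> 1/2" using AB by simp_all
  moreover have "\<bar>A - B\<bar> \<le> A + B" using AB by simp
  ultimately have "(x, \<eta>' h, \<rho>' h, z' h) \<in> D_HC"
    using x r by (simp add: D_HC_def E flip: A B)
  moreover have "(A + B)\<^sup>2 - (A - B)\<^sup>2 = 4 * A * B"
    by (simp add: power2_eq_square algebra_simps)
  hence "P_HC x (\<eta>' h) (\<rho>' h) (z' h) = 1"
    unfolding P_HC_def E A[symmetric] B[symmetric] using AB by simp
  ultimately have "(x, \<eta>' h, \<rho>' h, z' h) \<in> D_HC" "P_HC x (\<eta>' h) (\<rho>' h) (z' h) = 1"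
    by simp_all
  with h show ?thesis unfolding Gamma_HC_eq by metis
qed

lemma K_pairs_approximated_by_HC:
  assumes KL: "(K, L) \<in> K_pairs 2" and g: "0 \<le> g" "g < Gamma_ch K L" and e: "Phi_ch K L < e"
  shows "\<exists>x \<eta> \<rho> z. (x, \<eta>, \<rho>, z) \<in> D_HC \<and> g < Gamma_HC x \<eta> \<rho> z \<and> Phi_HC x \<eta> \<rho> z < e"
proof -
  obtain x \<eta> \<rho> z P where x: "0 < x" "x \<le> 1/2" and \<eta>: "0 \<le> \<eta>" "\<eta> \<le> 1/2"
    and \<rho>: "0 \<le> \<rho>" "\<rho> \<le> 1/2" and z: "0 \<le> z" "z \<le> 1/2" and P: "0 \<le> P" "P \<le> 1"
    and E: "(E_HC z)\<^sup>2 = (A_HC x \<eta> - B_HC x \<rho>)\<^sup>2 + 4 * A_HC x \<eta> * B_HC x \<rho> * P"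
    and \<Phi>: "Phi_ch K L = Phi_HC x \<eta> \<rho> z" and \<Gamma>: "Gamma_ch K L = overlap_HC x \<eta> \<rho> P"
    using K_pairs_reduction[OF KL le_less_trans[OF g]] by (elim exE conjE) (rule that; assumption)
  define A B where A: "A = A_HC x \<eta>" and B: "B = B_HC x \<rho>"
  have AB: "0 \<le> A" "0 \<le> B" using x \<eta> \<rho> by (simp_all add: A B A_HC_def B_HC_def)
  have E0: "0 \<le> E_HC z" using z by (simp add: E_HC_def)
  show ?thesis
  proof (cases "\<eta> = 1/2 \<or> \<rho> = 1/2")
    case True
    \<comment> \<open>With a scalar matrix one length is zero, so the angle drops out of the law of
      cosines. The two weighted sums in the overlap coincide as well, and \<open>P\<close> may be
      replaced by 1.\<close>
    hence "A * B = 0" by (auto simp: A B A_HC_def B_HC_def)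
    hence "(E_HC z)\<^sup>2 = (A + B)\<^sup>2"
      unfolding E A[symmetric] B[symmetric] by (auto simp: power2_eq_square algebra_simps)
    hence "E_HC z = A + B" using E0 AB by simp
    moreover have "sqrt ((1 - \<eta>) * (1 - \<rho>)) + sqrt (\<eta> * \<rho>) =
        sqrt (\<rho> * (1 - \<eta>)) + sqrt (\<eta> * (1 - \<rho>))"
      using True
    proof
      assume "\<eta> = 1/2"
      show ?thesis unfolding \<open>\<eta> = 1/2\<close> by (simp add: mult.commute)
    next
      assume "\<rho> = 1/2"
      show ?thesis unfolding \<open>\<rho> = 1/2\<close> by (simp add: mult.commute)
    qed
    hence "overlap_HC x \<eta> \<rho> P = overlap_HC x \<eta> \<rho> 1"
      unfolding overlap_HC_def by (simp flip: distrib_right)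
    ultimately have "E_HC z = A_HC x \<eta> + B_HC x \<rho>" "g < overlap_HC x \<eta> \<rho> 1" "Phi_HC x \<eta> \<rho> z < e"
      using g e \<Phi> \<Gamma> by (simp_all add: A B)
    from HC_near_boundary[OF x \<eta> \<rho> this] show ?thesis by blast
  next
    case False
    hence AB': "0 < A" "0 < B" using x \<eta> \<rho> by (simp_all add: A B A_HC_def B_HC_def)
    have "P_HC x \<eta> \<rho> z = P"
      unfolding P_HC_def E using AB' by (simp flip: A B)
    moreover have "\<bar>A - B\<bar> \<le> E_HC z"
      using E P AB by (intro power2_le_imp_le[OF _ E0]) (simp flip: A B)
    moreover have "E_HC z \<le> A + B"
    proof (rule power2_le_imp_le)
      have "(E_HC z)\<^sup>2 \<le> (A - B)\<^sup>2 + 4 * A * B * 1"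
        unfolding E A[symmetric] B[symmetric] using P AB by (intro add_left_mono mult_left_mono) simp_all
      thus "(E_HC z)\<^sup>2 \<le> (A + B)\<^sup>2" by (simp add: power2_eq_square algebra_simps)
    qed (use AB in simp)
    ultimately have "(x, \<eta>, \<rho>, z) \<in> D_HC" "g < Gamma_HC x \<eta> \<rho> z"
      using False x \<eta> \<rho> z g \<Gamma> by (auto simp: D_HC_def Gamma_HC_eq A B)
    with e show ?thesis unfolding \<Phi> by blast
  qed
qed

section \<open>Equality of the two infima for size two\<close>

lemma kappa_ch_1_eq:
  assumes "0 < \<delta>" "\<delta> < 1/2"
  shows "kappa_ch 1 \<delta> = kappa_HC \<delta>"
  unfolding kappa_ch_def kappa_HC_def one_add_one
proof (rule Inf_eq_if_approx)
  \<comment> \<open>This point corresponds to \<open>K = L\<close>, half of a rank-one projection,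
    where the overlap is 1.\<close>
  have "(1/2, 0, 0, 0) \<in> D_HC" "Gamma_HC (1/2) 0 0 0 = 1"
    by (simp_all add: D_HC_def A_HC_def B_HC_def E_HC_def Gamma_HC_def P_HC_def real_sqrt_mult real_sqrt_divide)
  thus "{Phi_HC x \<eta> \<rho> z |x \<eta> \<rho> z. (x, \<eta>, \<rho>, z) \<in> D_HC \<and> 1 - 2 * \<delta> < Gamma_HC x \<eta> \<rho> z} \<noteq> {}"
    using assms by force
  \<comment> \<open>A crude bound: only the last entropy enters with a minus sign.\<close>
  have "- H2 (1/2) \<le> Phi_HC x \<eta> \<rho> z" if "(x, \<eta>, \<rho>, z) \<in> D_HC" for x \<eta> \<rho> z
  proof -
    have "0 \<le> H2 x" "0 \<le> (1 - x) * H2 \<eta>" "0 \<le> x * H2 \<rho>" "H2 z \<le> H2 (1/2)"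
      using that H2_nonneg[of x] H2_nonneg[of \<eta>] H2_nonneg[of \<rho>] H2_mono[of z "1/2"]
      by (auto simp: D_HC_def)
    thus ?thesis by (simp add: Phi_HC_def)
  qed
  thus "bdd_below {Phi_HC x \<eta> \<rho> z |x \<eta> \<rho> z. (x, \<eta>, \<rho>, z) \<in> D_HC \<and> 1 - 2 * \<delta> < Gamma_HC x \<eta> \<rho> z}"
    by (intro bdd_belowI[of _ "- H2 (1/2)"]) blast
next
  fix s e :: real
  assume "s \<in> {Phi_ch K L |K L. (K, L) \<in> K_pairs 2 \<and> 1 - 2 * \<delta> < Gamma_ch K L}" and e: "0 < e"
  then obtain K L where "s = Phi_ch K L" "(K, L) \<in> K_pairs 2" "1 - 2 * \<delta> < Gamma_ch K L" by blast
  with K_pairs_approximated_by_HC[of K L "1 - 2 * \<delta>" "s + e"] assms e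
  show "\<exists>t\<in>{Phi_HC x \<eta> \<rho> z |x \<eta> \<rho> z. (x, \<eta>, \<rho>, z) \<in> D_HC \<and> 1 - 2 * \<delta> < Gamma_HC x \<eta> \<rho> z}. t < s + e"
    by fastforce
next
  fix t e :: real
  assume "t \<in> {Phi_HC x \<eta> \<rho> z |x \<eta> \<rho> z. (x, \<eta>, \<rho>, z) \<in> D_HC \<and> 1 - 2 * \<delta> < Gamma_HC x \<eta> \<rho> z}" and e: "0 < e"
  then obtain x \<eta> \<rho> z where *: "t = Phi_HC x \<eta> \<rho> z" "(x, \<eta>, \<rho>, z) \<in> D_HC" "1 - 2 * \<delta> < Gamma_HC x \<eta> \<rho> z"
    by blast
  from HC_realized_by_matrices[OF *(2)] obtain K L where
    "(K, L) \<in> K_pairs 2" "Phi_ch K L = Phi_HC x \<eta> \<rho> z" "Gamma_ch K L = Gamma_HC x \<eta> \<rho> z" by blast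
  with * have "t \<in> {Phi_ch K L |K L. (K, L) \<in> K_pairs 2 \<and> 1 - 2 * \<delta> < Gamma_ch K L}"
    by (metis (mono_tags, lifting) mem_Collect_eq)
  thus "\<exists>s\<in>{Phi_ch K L |K L. (K, L) \<in> K_pairs 2 \<and> 1 - 2 * \<delta> < Gamma_ch K L}. s < t + e"
    by (rule bexI[rotated]) (use e in simp)
qed

section \<open>Matrices of size one\<close>

lemma mat_diag_dim [simp]: "dim_row (mat_diag n f) = n" "dim_col (mat_diag n f) = n"
  by (simp_all add: mat_diag_def)

lemma mat_adjoint_one: "mat_adjoint (1\<^sub>m n) = (1\<^sub>m n :: complex mat)"
  by (rule eq_matI) auto

lemma one_conj_mat_diag: "1\<^sub>m n * mat_diag n f * 1\<^sub>m n = (mat_diag n f :: complex mat)"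
  by (simp add: right_mult_one_mat[of _ n n] left_mult_one_mat[of _ n n])

lemma diagonalizes_scalar: "diagonalizes (1\<^sub>m 1) (\<lambda>_. k) (mat_diag 1 (\<lambda>_. complex_of_real k))"
  unfolding diagonalizes_def unitary_def by (simp only: mat_adjoint_one one_conj_mat_diag mat_diag_dim) simp

lemma herm_fun_scalar:
  "herm_fun f (mat_diag 1 (\<lambda>_. complex_of_real k)) = mat_diag 1 (\<lambda>_. complex_of_real (f k))"
  unfolding herm_fun_eq[OF diagonalizes_scalar[of k]] by (simp only: mat_adjoint_one one_conj_mat_diag mat_diag_dim)

lemma mat_diag_1_mult:
  "mat_diag 1 (\<lambda>_. a) * mat_diag 1 (\<lambda>_. b) = mat_diag 1 (\<lambda>_. a * b :: complex)"
  by (simp add: mat_diag_diag)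

lemma mat_trace_mat_diag_1: "mat_trace (mat_diag 1 (\<lambda>_. a)) = a"
  by (simp add: mat_trace_def mat_diag_def)

lemma entropy_scalar: "entropy (mat_diag 1 (\<lambda>_. complex_of_real k)) = - (k * log 2 k)"
  by (simp add: entropy_def herm_fun_scalar mat_diag_1_mult mat_trace_mat_diag_1 del: One_nat_def)

lemma psd_scalar_iff: "psd (mat_diag 1 (\<lambda>_. complex_of_real k)) \<longleftrightarrow> 0 \<le> k"
proof
  have form: "(mat_diag 1 (\<lambda>_. complex_of_real k) *\<^sub>v v) \<bullet>c v = complex_of_real (k * (cmod (v $ 0))\<^sup>2)"
    if "v \<in> carrier_vec 1" for v
    using that by (simp add: scalar_prod_def mat_diag_def flip: complex_norm_square)
  {
    assume "psd (mat_diag 1 (\<lambda>_. complex_of_real k))"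
    hence "0 \<le> (mat_diag 1 (\<lambda>_. complex_of_real k) *\<^sub>v vec 1 (\<lambda>_. 1)) \<bullet>c vec 1 (\<lambda>_. 1)"
      by (auto simp: psd_def mat_diag_def)
    thus "0 \<le> k" by (subst (asm) form) (auto simp: less_eq_complex_def)
  }
  assume "0 \<le> k"
  thus "psd (mat_diag 1 (\<lambda>_. complex_of_real k))"
    using form unfolding psd_def hermitian_def
    by (auto intro!: eq_matI simp: mat_diag_def less_eq_complex_def)
qed

lemma K_pairs_1_iff:
  "(K, L) \<in> K_pairs 1 \<longleftrightarrow> (\<exists>k. 0 \<le> k \<and> k \<le> 1 \<and> K = mat_diag 1 (\<lambda>_. complex_of_real (1 - k)) \<and>
     L = mat_diag 1 (\<lambda>_. complex_of_real k))"
proof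
  assume *: "(K, L) \<in> K_pairs 1"
  have ex: "\<exists>k. 0 \<le> k \<and> M = mat_diag 1 (\<lambda>_. complex_of_real k)" if "M \<in> carrier_mat 1 1" "psd M" for M
  proof -
    have "M $$ (0, 0) = cnj (M $$ (0, 0))"
      using that mat_adjoint_index[of 0 M 0] by (simp add: psd_def hermitian_def)
    hence "M = mat_diag 1 (\<lambda>_. complex_of_real (Re (M $$ (0, 0))))"
      using that(1) by (intro eq_matI) (auto simp: mat_diag_def complex_eq_iff)
    thus ?thesis using that(2) psd_scalar_iff by metis
  qed
  have "K \<in> carrier_mat 1 1" "psd K" "L \<in> carrier_mat 1 1" "psd L"
    using * by (auto simp: K_pairs_def)
  from ex[OF this(1,2)] ex[OF this(3,4)] obtain k l where k: "0 \<le> k" "K = mat_diag 1 (\<lambda>_. complex_of_real k)"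
    and l: "0 \<le> l" "L = mat_diag 1 (\<lambda>_. complex_of_real l)" by blast
  have "complex_of_real (k + l) = 1"
    using * by (simp add: K_pairs_def k l mat_trace_def mat_diag_def)
  hence "k = 1 - l" by (simp add: complex_eq_iff)
  with k l show "\<exists>k. 0 \<le> k \<and> k \<le> 1 \<and> K = mat_diag 1 (\<lambda>_. complex_of_real (1 - k)) \<and>
     L = mat_diag 1 (\<lambda>_. complex_of_real k)" by (intro exI[of _ l]) simp
next
  assume "\<exists>k. 0 \<le> k \<and> k \<le> 1 \<and> K = mat_diag 1 (\<lambda>_. complex_of_real (1 - k)) \<and>
     L = mat_diag 1 (\<lambda>_. complex_of_real k)"
  then obtain k where k: "0 \<le> k" "k \<le> 1" "K = mat_diag 1 (\<lambda>_. complex_of_real (1 - k))"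
     "L = mat_diag 1 (\<lambda>_. complex_of_real k)" by blast
  have "psd K" "psd L" using k(1,2) unfolding k(3,4) psd_scalar_iff by simp_all
  thus "(K, L) \<in> K_pairs 1"
    by (simp add: K_pairs_def) (simp add: k mat_trace_def mat_diag_def)
qed

lemma scalar_pair:
  assumes "K = mat_diag 1 (\<lambda>_. complex_of_real (1 - k))" "L = mat_diag 1 (\<lambda>_. complex_of_real k)"
  shows "Phi_ch K L = H2 k" "Gamma_ch K L = 2 * sqrt (k * (1 - k))"
proof -
  have "K + L = mat_diag 1 (\<lambda>_. complex_of_real 1)"
    unfolding assms by (rule eq_matI) (auto simp: mat_diag_def)
  thus "Phi_ch K L = H2 k"
    unfolding Phi_ch_def by (simp only: assms entropy_scalar) (simp add: H2_def)
  show "Gamma_ch K L = 2 * sqrt (k * (1 - k))"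
    unfolding Gamma_ch_def assms herm_fun_scalar mat_diag_1_mult mat_trace_mat_diag_1
    by (simp add: real_sqrt_mult)
qed

lemma power2_less_iff:
  fixes a b :: real
  assumes "0 \<le> a" "0 \<le> b"
  shows "a\<^sup>2 < b\<^sup>2 \<longleftrightarrow> a < b"
  using assms by (meson power2_less_imp_less power_strict_mono zero_less_numeral)

text \<open>The constraint is an open interval of radius \<open>\<tau>\<close> about 1/2. By
  symmetry and monotonicity \<open>H2\<close> is bounded below there by its value at the left end,
  which continuity makes the infimum.\<close>

lemma kappa_ch_0_eq:
  assumes "0 < \<delta>" "\<delta> < 1/2"
  shows "kappa_ch 0 \<delta> = M1 \<delta>"
proof -
  define \<tau> where "\<tau> = sqrt (\<delta> * (1 - \<delta>))"
  have \<tau>2: "\<tau>\<^sup>2 = \<delta> * (1 - \<delta>)" and \<tau>0: "0 < \<tau>" using assms by (simp_all add: \<tau>_def)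
  \<comment> \<open>The difference between 1/4 and \<open>\<delta> * (1 - \<delta>)\<close> is this
    square.\<close>
  have "0 < (1/2 - \<delta>)\<^sup>2" using assms by simp
  hence "\<tau>\<^sup>2 < (1/2)\<^sup>2" unfolding \<tau>2 by (simp add: power2_eq_square field_simps)
  hence \<tau>1: "\<tau> < 1/2" by (rule power2_less_imp_less) simp
  have overlap: "1 - 2 * \<delta> < 2 * sqrt (k * (1 - k)) \<longleftrightarrow> \<bar>k - 1/2\<bar> < \<tau>" if "0 \<le> k" "k \<le> 1" for k
  proof -
    have "1 - 2 * \<delta> < 2 * sqrt (k * (1 - k)) \<longleftrightarrow> (1 - 2 * \<delta>)\<^sup>2 < (2 * sqrt (k * (1 - k)))\<^sup>2"
      using assms that by (intro power2_less_iff[symmetric]) simp_all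
    also have "\<dots> \<longleftrightarrow> (1 - 2 * \<delta>)\<^sup>2 < 4 * (k * (1 - k))"
      using that by (simp add: power_mult_distrib)
    \<comment> \<open>Both sides are completed to squares: they are 1 minus four times
      \<open>\<tau>\<^sup>2\<close> and 1 minus four times \<open>(k - 1/2)\<^sup>2\<close>.\<close>
    also have "\<dots> \<longleftrightarrow> \<bar>k - 1/2\<bar>\<^sup>2 < \<tau>\<^sup>2"
      unfolding \<tau>2 power2_abs by (simp add: power2_eq_square field_simps)
    also have "\<dots> \<longleftrightarrow> \<bar>k - 1/2\<bar> < \<tau>"
      using \<tau>0 by (intro power2_less_iff) simp_all
    finally show ?thesis .
  qed
  have "{Phi_ch K L |K L. (K, L) \<in> K_pairs (0 + 1) \<and> 1 - 2 * \<delta> < Gamma_ch K L} = H2 ` {k. \<bar>k - 1/2\<bar> < \<tau>}"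
    (is "?S = ?T")
  proof (intro equalityI subsetI)
    fix s assume "s \<in> ?S"
    then obtain K L where s: "s = Phi_ch K L" "(K, L) \<in> K_pairs 1" "1 - 2 * \<delta> < Gamma_ch K L"
      by auto
    from s(2) obtain k where k: "0 \<le> k" "k \<le> 1" "K = mat_diag 1 (\<lambda>_. complex_of_real (1 - k))"
     "L = mat_diag 1 (\<lambda>_. complex_of_real k)" unfolding K_pairs_1_iff by blast
    show "s \<in> ?T" using s(1,3) overlap[OF k(1,2)] unfolding scalar_pair[OF k(3,4)] by blast
  next
    fix s assume "s \<in> ?T"
    then obtain k where s: "s = H2 k" and k: "\<bar>k - 1/2\<bar> < \<tau>" by blast
    have k01: "0 \<le> k" "k \<le> 1" using k \<tau>1 by auto
    define K L where "K = mat_diag 1 (\<lambda>_. complex_of_real (1 - k))"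
      and "L = mat_diag 1 (\<lambda>_. complex_of_real k)"
    have "(K, L) \<in> K_pairs (0 + 1)" unfolding add_0 K_pairs_1_iff using k01 K_def L_def by blast
    with s k overlap[OF k01] scalar_pair[OF K_def L_def] show "s \<in> ?S" by force
  qed
  hence "kappa_ch 0 \<delta> = Inf (H2 ` {k. \<bar>k - 1/2\<bar> < \<tau>})"
    unfolding kappa_ch_def by simp
  also have "\<dots> = Inf {H2 (1/2 - \<tau>)}"
  proof (rule Inf_eq_if_approx)
    fix s e :: real assume "s \<in> H2 ` {k. \<bar>k - 1/2\<bar> < \<tau>}" "0 < e"
    then obtain k where k: "s = H2 k" "\<bar>k - 1/2\<bar> < \<tau>" by blast
    have "H2 (1/2 - \<tau>) \<le> H2 k"
    proof (cases "k \<le> 1/2")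
      case True
      thus ?thesis using k \<tau>1 by (intro H2_mono) auto
    next
      case False
      hence "H2 (1/2 - \<tau>) \<le> H2 (1 - k)" using k \<tau>1 by (intro H2_mono) auto
      thus ?thesis by (simp add: H2_symmetric)
    qed
    thus "\<exists>t\<in>{H2 (1/2 - \<tau>)}. t < s + e" using k \<open>0 < e\<close> by simp
  next
    fix t e :: real assume t: "t \<in> {H2 (1/2 - \<tau>)}" and "0 < e"
    \<comment> \<open>The end point itself violates the strict constraint, so it is approached from
      inside the interval.\<close>
    have "(H2 \<longlongrightarrow> H2 (1/2 - \<tau>)) (at_right (1/2 - \<tau>))"
      using isCont_H2 by (simp add: isCont_def filterlim_at_split)
    hence "\<forall>\<^sub>F k in at_right (1/2 - \<tau>). H2 k < t + e"
      by (rule order_tendstoD) (use t \<open>0 < e\<close> in simp)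
    moreover have "\<forall>\<^sub>F k in at_right (1/2 - \<tau>). k \<in> {1/2 - \<tau><..<1/2}"
      using \<tau>0 by (intro eventually_at_right_real) simp
    ultimately have "\<forall>\<^sub>F k in at_right (1/2 - \<tau>). H2 k < t + e \<and> k \<in> {1/2 - \<tau><..<1/2}"
      by (rule eventually_conj)
    from eventually_happens[OF this] obtain k where "H2 k < t + e" "1/2 - \<tau> < k" "k < 1/2" by auto
    thus "\<exists>s\<in>H2 ` {k. \<bar>k - 1/2\<bar> < \<tau>}. s < t + e" by (intro bexI[of _ "H2 k"] imageI) auto
  qed simp_all
  finally show ?thesis by (simp add: M1_def \<tau>_def)
qed

theorem proposition8p4:
  fixes \<delta> :: real
  assumes "0 < \<delta>" and "\<delta> < 1/2"
  shows "kappa_ch 0 \<delta> = M1 \<delta> \<and> kappa_ch 1 \<delta> = kappa_HC \<delta>"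
  using kappa_ch_0_eq[OF assms] kappa_ch_1_eq[OF assms] by blast

end
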